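(* Let $F$ be a field, $\lambda\ge 0$ an integer, and $A_1,\dots,A_n$ $\lambda$-Vandermonde finite subsets of $F$. Let $f\in F[X_1,\dots,X_n]$ be a polynomial in which the degree of each variable $X_i$ is at most $\lambda$. Then \[\sum_{a\in A_1\times\dots\times A_n}f(a)=f(0)\,|A_1|\cdots|A_n|.\]
   Context: A finite non-empty subset $A\subseteq F$ is $\lambda$-Vandermonde (for $\lambda\in\{0,\dots,|A|\}$) if $\sum_{a\in A}a^r=0$ for all $1\le r\le\lambda$. *)

theory Defs
  imports Complex_Main "HOL-Library.Poly_Mapping" "HOL-Library.FuncSet"
begin

definition vandermonde :: "nat \<Rightarrow> 'a::field set \<Rightarrow> bool" where
  "vandermonde l A \<longleftrightarrow>
     finite A \<and> A \<noteq> {} \<and> l \<le> card A \<and> (\<forall>r\<in>{1..l}. (\<Sum>a\<in>A. a ^ r) = 0)"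

text \<open>
  A polynomial is a finitely supported map from monomials to coefficients; a monomial is a
  finitely supported map from variable indices to exponents.  The polynomials in
  \<open>F[X\<^sub>1,\<dots>,X\<^sub>n]\<close> are those with \<open>mvars f \<subseteq> {1..n}\<close>.
\<close>

type_synonym 'a mpoly = "(nat \<Rightarrow>\<^sub>0 nat) \<Rightarrow>\<^sub>0 'a"

definition mvars :: "'a::zero mpoly \<Rightarrow> nat set" where
  "mvars f = (\<Union>m\<in>Poly_Mapping.keys f. Poly_Mapping.keys m)"

text \<open>The \<open>insert 0\<close> gives the zero polynomial degree 0 in every variable.\<close>

definition degree_in :: "'a::zero mpoly \<Rightarrow> nat \<Rightarrow> nat" where
  "degree_in f i = Max (insert 0 ((\<lambda>m. Poly_Mapping.lookup m i) ` Poly_Mapping.keys f))"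

definition meval :: "'a::comm_semiring_1 mpoly \<Rightarrow> (nat \<Rightarrow> 'a) \<Rightarrow> 'a" where
  "meval f x = (\<Sum>m\<in>Poly_Mapping.keys f.
     Poly_Mapping.lookup f m * (\<Prod>i\<in>Poly_Mapping.keys m. x i ^ Poly_Mapping.lookup m i))"

end

theory Submission
  imports Defs
begin

text \<open>By linearity it suffices to treat a single monomial of \<open>f\<close>. Its sum over
  the grid factors into one-variable power sums over the \<open>A i\<close>, with exponents at most
  \<open>l\<close>. By \<open>vandermonde_sum_power\<close> each factor is \<open>card (A i)\<close>
  for exponent 0 and vanishes otherwise, so only the constant term survives, multiplied by the size
  of the grid.\<close>

text \<open>Absent variables contribute \<open>x i ^ 0 = 1\<close>. A common index set for all
  monomials is what lets the grid sum factor.\<close>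

lemma meval_extend_vars:
  assumes "finite V" "mvars f \<subseteq> V"
  shows "meval f x = (\<Sum>m\<in>Poly_Mapping.keys f.
           Poly_Mapping.lookup f m * (\<Prod>i\<in>V. x i ^ Poly_Mapping.lookup m i))"
  unfolding meval_def
proof (intro sum.cong refl arg_cong2[where f = "(*)"] prod.mono_neutral_left)
  fix m assume "m \<in> Poly_Mapping.keys f"
  then show "Poly_Mapping.keys m \<subseteq> V"
    using assms(2) by (auto simp: mvars_def)
qed (use assms in \<open>auto simp: in_keys_iff\<close>)

lemma lookup_le_degree_in:
  assumes "m \<in> Poly_Mapping.keys f"
  shows "Poly_Mapping.lookup m i \<le> degree_in f i"
  unfolding degree_in_def using assms by (intro Max_ge) auto

text \<open>With \<open>0 ^ 0 = 1\<close>, the factor \<open>0 ^ k\<close> is the value of the k-th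
  power at the origin; it merges the counting case \<open>k = 0\<close> with the vanishing power
  sums.\<close>

lemma vandermonde_sum_power:
  assumes "vandermonde l A" "k \<le> l"
  shows "(\<Sum>a\<in>A. a ^ k) = 0 ^ k * of_nat (card A)"
  using assms by (cases "k = 0") (auto simp: vandermonde_def)

theorem theorem5p4:
  fixes l n :: nat
    and A :: "nat \<Rightarrow> 'a::field set"
    and f :: "'a mpoly"
  assumes "\<And>i. i \<in> {1..n} \<Longrightarrow> vandermonde l (A i)"
    and "mvars f \<subseteq> {1..n}"
    and "\<And>i. i \<in> {1..n} \<Longrightarrow> degree_in f i \<le> l"
  shows "(\<Sum>a\<in>(\<Pi>\<^sub>E i\<in>{1..n}. A i). meval f a)
           = meval f (\<lambda>_. 0) * (\<Prod>i=1..n. of_nat (card (A i)))"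
proof -
  let ?c = "Poly_Mapping.lookup f"
  let ?e = "Poly_Mapping.lookup :: (nat \<Rightarrow>\<^sub>0 nat) \<Rightarrow> nat \<Rightarrow> nat"
  have fin: "finite (A i)" if "i \<in> {1..n}" for i
    using assms(1)[OF that] by (simp add: vandermonde_def)
  have monomial: "(\<Sum>a\<in>(\<Pi>\<^sub>E i\<in>{1..n}. A i). \<Prod>i=1..n. a i ^ ?e m i)
      = (\<Prod>i=1..n. 0 ^ ?e m i) * (\<Prod>i=1..n. of_nat (card (A i)))"
    if m: "m \<in> Poly_Mapping.keys f" for m
  proof -
    have "(\<Sum>a\<in>(\<Pi>\<^sub>E i\<in>{1..n}. A i). \<Prod>i=1..n. a i ^ ?e m i)
        = (\<Prod>i=1..n. \<Sum>a\<in>A i. a ^ ?e m i)"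
      \<comment> \<open>Distributivity, read from the expanded sum back to the product.\<close>
      using fin by (subst prod_sum_PiE) auto
    also have "\<dots> = (\<Prod>i=1..n. 0 ^ ?e m i * of_nat (card (A i)))"
      using assms(1,3) lookup_le_degree_in[OF m]
      by (intro prod.cong refl vandermonde_sum_power[of l]) (auto intro: order_trans)
    finally show ?thesis by (simp add: prod.distrib)
  qed
  have "(\<Sum>a\<in>(\<Pi>\<^sub>E i\<in>{1..n}. A i). meval f a)
      = (\<Sum>m\<in>Poly_Mapping.keys f. ?c m *
           (\<Sum>a\<in>(\<Pi>\<^sub>E i\<in>{1..n}. A i). \<Prod>i=1..n. a i ^ ?e m i))"
    unfolding meval_extend_vars[OF finite_atLeastAtMost assms(2)] sum_distrib_left
    by (rule sum.swap)
  \<comment> \<open>The products of \<open>0 ^ ?e m i\<close> reassemble, with their coefficients,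
    into \<open>f\<close> evaluated at the origin.\<close>
  also have "\<dots> = meval f (\<lambda>_. 0) * (\<Prod>i=1..n. of_nat (card (A i)))"
    unfolding meval_extend_vars[OF finite_atLeastAtMost assms(2)] sum_distrib_right
    by (intro sum.cong refl) (simp only: monomial mult.assoc)
  finally show ?thesis .
qed

end
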